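(* Let $0<\alpha<1$ and $k^t,k^d\in\mathbb{N}$ be such that $\alpha\left\lceil\frac{k^d}{k^t}\right\rceil\ge 1$. There is an instance $I$ of the relief distribution problem with $k^t$ trucks, $k^d$ drones and drone speed $\alpha$ such that $$\frac{\mathrm{Optimistic}(I)}{\mathrm{OPT}(I^* )}=2.$$
   Context: Relief distribution problem (RDP). $\mathbb{N}=\{1,2,\dots\}$. An instance is $I=(k^t,k^d,\alpha,G,D)$: $k^t,k^d\in\mathbb{N}$ are the numbers of trucks and drones; $\alpha>0$ is the drone speed; $G=(V,E,c)$ is a finite connected undirected graph (not necessarily complete) with $V=\{v_0\}\cup C$, where $v_0$ is the depot and $C\neq\emptyset$ is the set of non-depot nodes; edge lengths $c(i,j)>0$ satisfy the triangle inequality; $D\subseteq C$ is the set of damaged nodes, initially unknown; the status of a node is revealed when some vehicle first arrives at it. For non-adjacent $i,j$, $c(i,j)$ is the shortest-path distance. A truck needs time $c(i,j)$ to traverse an edge, a drone needs $\frac1\alpha c(i,j)$. A tour is a closed walk in $G$ starting and ending at $v_0$ (possibly of length $0$); it visits all nodes lying on it. The makespan of a family of tours is the maximum duration of a tour. Full-information optimum: $\mathrm{OPT}(I^* )$ is the minimum makespan over all families of $k^t$ truck tours and $k^d$ drone tours such that every node of $C$ is visited by some vehicle and every node of $D$ is visited by a truck ($I^*$ is the instance $I$ with $D$ known in advance). For integers $m,n\ge 0$ with $m+n\ge1$ and $W\subseteq C$, $\mathrm{TSP}_{m,n}(W)$ denotes the minimum makespan over all families of $m$ truck tours and $n$ drone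 tours that together visit all nodes of $W$, and $S^*_{m,n}(W)$ denotes an optimal such family. Policy Optimistic (deterministic; optimal families are selected by a fixed rule based only on the information available at that time, so the first-stage tours do not depend on $D$). First stage: the vehicles execute the tours of $S^*_{k^t,k^d}(C)$ and return to the depot. Let $D^d\subseteq D$ be the set of damaged nodes not visited by truck tours in this stage. Second stage (after all vehicles returned): the trucks execute $S^*_{k^t,0}(D^d)$. Its makespan is $\mathrm{Optimistic}(I)=\mathrm{TSP}_{k^t,k^d}(C)+\mathrm{TSP}_{k^t,0}(D^d)$. *)

theory Defs
  imports Complex_Main "Graph_Theory.Graph_Theory"
begin

text \<open>
  Finite undirected graphs are symmetric loop-free digraphs without parallel arcs (locale
  \<open>pair_graph\<close>); the length of an undirected edge is stored on both of its orientations.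

  The record is split in two so that the part known to a policy in advance is a type of its own:
  a selection rule takes an argument of type \<open>'v rdp_public\<close>, which does not
  contain the set of damaged nodes.
\<close>

record 'v rdp_public =
  road :: "'v pair_pre_digraph"
  depot :: 'v
  edge_len :: "'v \<times> 'v \<Rightarrow> real"
  num_trucks :: nat
  num_drones :: nat
  speed :: real

record 'v rdp = "'v rdp_public" +
  damaged :: "'v set"

definition customers :: "('v, 'z) rdp_public_scheme \<Rightarrow> 'v set" where
  "customers P = pverts (road P) - {depot P}"

definition cost :: "('v, 'z) rdp_public_scheme \<Rightarrow> ('v \<times> 'v) awalk \<Rightarrow> real" where
  "cost P p = wf_digraph.awalk_cost (edge_len P) p"

definition distance :: "('v, 'z) rdp_public_scheme \<Rightarrow> 'v \<Rightarrow> 'v \<Rightarrow> ereal" where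
  "distance P u v =
     (if (u, v) \<in> parcs (road P) then ereal (edge_len P (u, v))
      else wf_digraph.\<mu> (with_proj (road P)) (edge_len P) u v)"

definition valid_public :: "('v, 'z) rdp_public_scheme \<Rightarrow> bool" where
  "valid_public P \<longleftrightarrow>
     pair_graph (road P) \<and> connected (with_proj (road P)) \<and>
     depot P \<in> pverts (road P) \<and> customers P \<noteq> {} \<and>
     (\<forall>(u, v) \<in> parcs (road P).
        0 < edge_len P (u, v) \<and> edge_len P (u, v) = edge_len P (v, u)) \<and>
     (\<forall>u \<in> pverts (road P). \<forall>v \<in> pverts (road P). \<forall>w \<in> pverts (road P).
        distance P u w \<le> distance P u v + distance P v w) \<and>
     1 \<le> num_trucks P \<and> 1 \<le> num_drones P \<and> 0 < speed P"

definition valid_rdp :: "'v rdp \<Rightarrow> bool" where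
  "valid_rdp I \<longleftrightarrow> valid_public I \<and> damaged I \<subseteq> customers I"

definition tour :: "('v, 'z) rdp_public_scheme \<Rightarrow> ('v \<times> 'v) awalk \<Rightarrow> bool" where
  "tour P p \<longleftrightarrow> pre_digraph.awalk (with_proj (road P)) (depot P) p (depot P)"

definition visits :: "('v, 'z) rdp_public_scheme \<Rightarrow> ('v \<times> 'v) awalk list \<Rightarrow> 'v set" where
  "visits P ps = (\<Union>p \<in> set ps. set (pre_digraph.awalk_verts (with_proj (road P)) (depot P) p))"

text \<open>A family consists of the list of truck tours and the list of drone tours.\<close>

type_synonym 'v family = "('v \<times> 'v) awalk list \<times> ('v \<times> 'v) awalk list"

definition families :: "('v, 'z) rdp_public_scheme \<Rightarrow> nat \<Rightarrow> nat \<Rightarrow> 'v family set" where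
  "families P m n =
     {(ts, ds). length ts = m \<and> length ds = n \<and> (\<forall>p \<in> set ts \<union> set ds. tour P p)}"

text \<open>Only meaningful for families with at least one tour.\<close>

definition makespan :: "('v, 'z) rdp_public_scheme \<Rightarrow> 'v family \<Rightarrow> real" where
  "makespan P F =
     Max (cost P ` set (fst F) \<union> (\<lambda>p. 1 / speed P * cost P p) ` set (snd F))"

definition tsp_feasible ::
  "('v, 'z) rdp_public_scheme \<Rightarrow> nat \<Rightarrow> nat \<Rightarrow> 'v set \<Rightarrow> 'v family \<Rightarrow> bool" where
  "tsp_feasible P m n W F \<longleftrightarrow>
     F \<in> families P m n \<and> W \<subseteq> visits P (fst F) \<union> visits P (snd F)"

definition tsp :: "('v, 'z) rdp_public_scheme \<Rightarrow> nat \<Rightarrow> nat \<Rightarrow> 'v set \<Rightarrow> real" where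
  "tsp P m n W = (LEAST t. \<exists>F. tsp_feasible P m n W F \<and> t = makespan P F)"

definition opt_feasible :: "'v rdp \<Rightarrow> 'v family \<Rightarrow> bool" where
  "opt_feasible I F \<longleftrightarrow>
     F \<in> families I (num_trucks I) (num_drones I) \<and>
     customers I \<subseteq> visits I (fst F) \<union> visits I (snd F) \<and>
     damaged I \<subseteq> visits I (fst F)"

definition opt :: "'v rdp \<Rightarrow> real" where
  "opt I = (LEAST t. \<exists>F. opt_feasible I F \<and> t = makespan I F)"

text \<open>
  A selection rule fixes one optimal family for every combination of public data, fleet and target
  set, that is, it resolves the ties among the optimal families.
\<close>

type_synonym 'v rule = "'v rdp_public \<Rightarrow> nat \<Rightarrow> nat \<Rightarrow> 'v set \<Rightarrow> 'v family"

definition selection_rule :: "'v rule \<Rightarrow> bool" where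
  "selection_rule S \<longleftrightarrow>
     (\<forall>P m n W. valid_public P \<and> 1 \<le> m + n \<and> W \<subseteq> customers P \<longrightarrow>
        is_arg_min (makespan P) (tsp_feasible P m n W) (S P m n W))"

definition first_stage :: "'v rule \<Rightarrow> 'v rdp \<Rightarrow> 'v family" where
  "first_stage S I =
     S (rdp_public.truncate I) (num_trucks I) (num_drones I) (customers I)"

definition remaining :: "'v rule \<Rightarrow> 'v rdp \<Rightarrow> 'v set" where
  "remaining S I = damaged I - visits I (fst (first_stage S I))"

definition optimistic :: "'v rule \<Rightarrow> 'v rdp \<Rightarrow> real" where
  "optimistic S I =
     tsp I (num_trucks I) (num_drones I) (customers I) +
     tsp I (num_trucks I) 0 (remaining S I)"

end

theory Submission
  imports Defs
begin

text \<open>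
  The instance is a star with centre \<open>v\<^sub>0\<close>, with \<open>q * k\<^sup>t + k\<^sup>d\<close> leaves and all edges of
  length \<open>1 / (2 * q)\<close>, where \<open>q = \<lceil>1 / \<alpha>\<rceil>\<close>. A tour of length \<open>l\<close> visits at most \<open>q * l\<close>
  leaves. Since \<open>1 \<le> q * \<alpha> < 2\<close>, within one unit of time a truck serves exactly \<open>q\<close> leaves and a
  drone exactly one. So the trucks leave at least \<open>k\<^sup>d\<close> leaves unvisited in any optimal first
  stage. The assumption on \<open>\<alpha>\<close> says \<open>q \<le> \<lceil>k\<^sup>d / k\<^sup>t\<rceil>\<close>, that is, \<open>(q - 1) * k\<^sup>t + 1 \<le> k\<^sup>d\<close>. Hence
  \<open>D\<close> can consist of \<open>(q - 1) * k\<^sup>t + 1\<close> leaves that the trucks do not visit; in the second stage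
  some truck has to serve \<open>q\<close> of them, which takes another unit of time, whereas with \<open>D\<close> known
  in advance one unit of time suffices for everything.
\<close>

section \<open>Shortest paths\<close>

lemma (in wf_digraph) \<mu>_nonneg:
  assumes "\<And>e. e \<in> arcs G \<Longrightarrow> 0 \<le> c e"
  shows "0 \<le> \<mu> c u v"
  unfolding \<mu>_def by (rule INF_greatest) (auto intro: pos_cost_pos_awalk_cost assms)

text \<open>Concatenation gives the bound for each pair of walks; the two infima are then taken one
  after the other. Pulling a summand out of an infimum requires a nonempty index set, hence the case
  split.\<close>

lemma (in wf_digraph) \<mu>_triangle:
  assumes nonneg: "\<And>e. e \<in> arcs G \<Longrightarrow> 0 \<le> c e"
  shows "\<mu> c u w \<le> \<mu> c u v + \<mu> c v w"
proof (cases "{p. awalk u p v} = {} \<or> {p. awalk v p w} = {}")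
  case True
  then have "\<mu> c u v = \<infinity> \<or> \<mu> c v w = \<infinity>"
    by (auto simp: \<mu>_def top_ereal_def)
  then show ?thesis using \<mu>_nonneg[of c] nonneg by fastforce
next
  case False
  have *: "\<mu> c u w \<le> ereal (awalk_cost c p) + ereal (awalk_cost c q)"
    if "awalk u p v" "awalk v q w" for p q
    using min_cost_le_walk_cost[OF awalk_appendI[OF that], of c] by simp
  have "\<mu> c u w \<le> ereal (awalk_cost c p) + \<mu> c v w" if "awalk u p v" for p
  proof -
    have "\<mu> c u w \<le> (INF q\<in>{q. awalk v q w}. ereal (awalk_cost c p) + ereal (awalk_cost c q))"
      using that * by (intro INF_greatest) auto
    also have "\<dots> = ereal (awalk_cost c p) + \<mu> c v w"
      using False unfolding \<mu>_def
      by (intro INF_ereal_add_right) (auto intro: pos_cost_pos_awalk_cost nonneg)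
    finally show ?thesis .
  qed
  then have "\<mu> c u w \<le> (INF p\<in>{p. awalk u p v}. ereal (awalk_cost c p) + \<mu> c v w)"
    by (intro INF_greatest) auto
  also have "\<dots> = \<mu> c u v + \<mu> c v w"
    using False \<mu>_nonneg[of c v w] nonneg unfolding \<mu>_def[of c u v]
    by (intro INF_ereal_add_left) (auto intro: pos_cost_pos_awalk_cost nonneg)
  finally show ?thesis .
qed

section \<open>Makespans\<close>

lemma makespan_less_iff:
  assumes "F \<in> families P m n" "1 \<le> m + n"
  shows "makespan P F < t \<longleftrightarrow>
    (\<forall>p \<in> set (fst F). cost P p < t) \<and> (\<forall>p \<in> set (snd F). 1 / speed P * cost P p < t)"
  unfolding makespan_def using assms
  by (subst Max_less_iff) (auto simp: families_def)

lemma makespan_le_iff: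
  assumes "F \<in> families P m n" "1 \<le> m + n"
  shows "makespan P F \<le> t \<longleftrightarrow>
    (\<forall>p \<in> set (fst F). cost P p \<le> t) \<and> (\<forall>p \<in> set (snd F). 1 / speed P * cost P p \<le> t)"
  unfolding makespan_def using assms
  by (subst Max_le_iff) (auto simp: families_def)

section \<open>Stars\<close>

definition star :: "nat \<Rightarrow> nat pair_pre_digraph" where
  "star n = \<lparr>pverts = {0..n}, parcs = {0} \<times> {1..n} \<union> {1..n} \<times> {0}\<rparr>"

lemma star_simps [simp]:
  "pverts (star n) = {0..n}"
  "parcs (star n) = {0} \<times> {1..n} \<union> {1..n} \<times> {0}"
  by (simp_all add: star_def)

lemma pair_graph_star: "pair_graph (star n)"
  by unfold_locales (auto simp: symmetric_def sym_def)

interpretation star: pair_graph "star n" for n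
  by (rule pair_graph_star)

lemma star_hub_reachable:
  assumes "v \<le> n"
  shows "0 \<rightarrow>\<^sup>*\<^bsub>with_proj (star n)\<^esub> v" and "v \<rightarrow>\<^sup>*\<^bsub>with_proj (star n)\<^esub> 0"
  using assms by (cases "v = 0"; auto intro!: star.reachable_adjI)+

lemma connected_star: "connected (with_proj (star n))"
proof (rule star.connectedI)
  fix u v assume "u \<in> pverts (star n)" "v \<in> pverts (star n)"
  then have "u \<rightarrow>\<^sup>*\<^bsub>with_proj (star n)\<^esub> v"
    using star.reachable_trans[OF star_hub_reachable(2) star_hub_reachable(1)] by simp
  then show "u \<rightarrow>\<^sup>*\<^bsub>mk_symmetric (with_proj (star n))\<^esub> v"
    by (rule star.reachable_mk_symmetricI)
qed auto

text \<open>The record scheme stays open so that the locale can be interpreted both for the public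
  data, the argument of a selection rule, and for a full instance.\<close>

locale star_rdp =
  fixes P :: "(nat, 'z) rdp_public_scheme" and n :: nat and h :: real
  assumes road [simp]: "road P = star n"
    and depot [simp]: "depot P = 0"
    and edge_len [simp]: "edge_len P = (\<lambda>_. h)"
    and h_pos: "0 < h"
begin

lemma customers: "customers P = {1..n}"
  by (auto simp: customers_def)

lemma cost_eq: "cost P p = h * length p"
  by (simp add: cost_def star.awalk_cost_def sum_list_triv)

text \<open>An edge is a shortest walk between its ends: these are distinct, so every walk joining
  them has at least one arc, of length \<open>h\<close>. The triangle inequality for
  \<open>distance\<close> is thus that for \<open>star.\<mu>\<close>.\<close>

lemma distance_eq: "distance P u v = star.\<mu> n (\<lambda>_. h) u v"
proof (cases "(u, v) \<in> parcs (star n)")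
  case True
  have "star.\<mu> n (\<lambda>_. h) u v \<le> star.awalk_cost (\<lambda>_. h) [(u, v)]"
    using True by (intro star.min_cost_le_walk_cost) (auto simp: star.awalk_def)
  moreover have "ereal h \<le> star.\<mu> n (\<lambda>_. h) u v"
    unfolding star.\<mu>_def
  proof (rule INF_greatest)
    fix p assume "p \<in> {p. star.awalk n u p v}"
    with True have "p \<noteq> []" by (auto simp: star.awalk_def)
    then have "1 \<le> real (length p)" by (cases p) auto
    then show "ereal h \<le> ereal (star.awalk_cost (\<lambda>_. h) p)"
      using h_pos by (simp add: star.awalk_cost_def sum_list_triv)
  qed
  ultimately have "star.\<mu> n (\<lambda>_. h) u v = ereal h" by (simp add: star.awalk_cost_def)
  then show ?thesis unfolding distance_def road edge_len by (simp only: if_P[OF True])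
next
  case False
  then show ?thesis unfolding distance_def road edge_len by (simp only: if_False)
qed

lemma valid:
  assumes "1 \<le> n" "1 \<le> num_trucks P" "1 \<le> num_drones P" "0 < speed P"
  shows "valid_public P"
  using assms h_pos star.\<mu>_triangle[of n "\<lambda>_. h"]
  by (auto simp: valid_public_def pair_graph_star connected_star customers distance_eq)

lemma tour_iff: "tour P p \<longleftrightarrow> set p \<subseteq> parcs (star n) \<and> pcas 0 p 0"
  by (auto simp: tour_def star.awalk_def)

lemma visits_eq: "visits P ps = (\<Union>p \<in> set ps. set (pawalk_verts 0 p))"
  by (simp add: visits_def awalk_verts_with_proj_eq)

text \<open>A tour enters and leaves every leaf that it visits.\<close>

lemma card_visited_le:
  assumes "tour P p" "0 \<notin> W"
  shows "2 * card (W \<inter> set (pawalk_verts 0 p)) \<le> length p"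
proof -
  let ?W = "W \<inter> set (pawalk_verts 0 p)"
  from assms have p: "star.awalk n 0 p 0" by (simp add: tour_def)
  have arcs: "(0, v) \<in> set p \<and> (v, 0) \<in> set p" if "v \<in> ?W" for v
  proof -
    from that assms have "v \<noteq> 0" by (metis IntD1)
    \<comment> \<open>Split at \<open>v\<close>, the walk enters \<open>v\<close> by the last arc of
      \<open>r\<close> and leaves it by the first arc of \<open>s\<close>; the only neighbour of a
      leaf is the hub 0.\<close>
    from that p obtain r s where rs: "p = r @ s" "star.awalk n 0 r v" "star.awalk n v s 0"
      using star.awalk_decomp[of n 0 p 0 v] by auto
    from \<open>v \<noteq> 0\<close> rs have "r \<noteq> []" "s \<noteq> []" by (auto simp: star.awalk_def)
    then obtain r' e f s' where [simp]: "r = r' @ [e]" "s = f # s'"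
      by (metis neq_Nil_conv rev_exhaust)
    have "snd e = v" "e \<in> parcs (star n)"
      using rs(2) by (auto simp: star.awalk_def star.cas_simp)
    moreover have "fst f = v" "f \<in> parcs (star n)"
      using rs(3) by (auto simp: star.awalk_def)
    ultimately have "e = (0, v)" "f = (v, 0)" using \<open>v \<noteq> 0\<close> by (auto simp: prod_eq_iff)
    with rs(1) show ?thesis by auto
  qed
  have "2 * card ?W = card (Pair (0 :: nat) ` ?W) + card ((\<lambda>v. (v, 0 :: nat)) ` ?W)"
    by (simp add: card_image inj_on_def)
  also have "\<dots> = card (Pair 0 ` ?W \<union> (\<lambda>v. (v, 0)) ` ?W)"
    using assms by (subst card_Un_disjoint) auto
  also have "\<dots> \<le> card (set p)"
    using arcs by (intro card_mono) auto
  also have "\<dots> \<le> length p" by (rule card_length)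
  finally show ?thesis .
qed

text \<open>Visiting \<open>r + 1\<close> leaves takes \<open>2 * (r + 1)\<close> arcs. The strict
  bound fits the later uses: \<open>length p < 2 * q\<close> yields \<open>r = q - 1\<close> for
  trucks, \<open>length p < 4\<close> yields \<open>r = 1\<close> for drones.\<close>

lemma card_visits_le:
  assumes "\<forall>p \<in> set ps. tour P p \<and> length p < 2 * (r + 1)" "0 \<notin> W"
  shows "card (W \<inter> visits P ps) \<le> length ps * r"
  using assms(1)
proof (induction ps)
  case (Cons p ps)
  have "W \<inter> visits P (p # ps) = (W \<inter> set (pawalk_verts 0 p)) \<union> (W \<inter> visits P ps)"
    by (auto simp: visits_eq)
  then have "card (W \<inter> visits P (p # ps)) \<le>
      card (W \<inter> set (pawalk_verts 0 p)) + card (W \<inter> visits P ps)"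
    by (simp add: card_Un_le)
  moreover have "card (W \<inter> set (pawalk_verts 0 p)) \<le> r"
    using card_visited_le[of p W] Cons.prems assms(2) by fastforce
  ultimately show ?case using Cons by fastforce
qed (simp add: visits_eq)

lemma ex_tour:
  assumes "set xs \<subseteq> {1..n}"
  shows "\<exists>p. tour P p \<and> length p = 2 * length xs \<and> set xs \<subseteq> set (pawalk_verts 0 p)"
  using assms
proof (induction xs)
  case Nil
  show ?case by (rule exI[of _ "[]"]) (auto simp: tour_iff)
next
  case (Cons x xs)
  then obtain p where "tour P p" "length p = 2 * length xs" "set xs \<subseteq> set (pawalk_verts 0 p)"
    by auto
  with Cons.prems show ?case
    by (intro exI[of _ "(0, x) # (x, 0) # p"]) (auto simp: tour_iff)
qed

text \<open>Greedy assignment: each tour in turn takes \<open>r\<close> of the leaves still missing,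
  or all of them if fewer remain. Once none is left, tours of length 0 fill up the family.\<close>

lemma ex_tours:
  assumes "W \<subseteq> {1..n}" "card W \<le> m * r"
  shows "\<exists>ps. length ps = m \<and> (\<forall>p \<in> set ps. tour P p \<and> length p \<le> 2 * r) \<and> W \<subseteq> visits P ps"
  using assms
proof (induction m arbitrary: W)
  case 0
  then have "W = {}" using finite_subset[of W "{1..n}"] by auto
  then show ?case by simp
next
  case (Suc m)
  have fin: "finite W" using Suc.prems finite_subset by auto
  obtain A where A: "A \<subseteq> W" "card A = min r (card W)"
    using obtain_subset_with_card_n[of "min r (card W)" W] by auto
  have finA: "finite A" using A fin finite_subset by auto
  have "card (W - A) \<le> m * r"
    using A Suc.prems by (simp add: card_Diff_subset[OF finA A(1)])
  then obtain ps where ps: "length ps = m" "\<forall>p \<in> set ps. tour P p \<and> length p \<le> 2 * r"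
      "W - A \<subseteq> visits P ps"
    using Suc.IH[of "W - A"] Suc.prems by auto
  obtain p where p: "tour P p" "length p = 2 * card A" "A \<subseteq> set (pawalk_verts 0 p)"
    using ex_tour[of "sorted_list_of_set A"] A Suc.prems finA by auto
  show ?case
    using p ps A by (intro exI[of _ "p # ps"]) (auto simp: visits_eq)
qed

end

section \<open>Stars matched to the drone speed\<close>

lemma card_le_covered:
  assumes "finite W" "W \<subseteq> A \<union> B"
  shows "card W \<le> card (W \<inter> A) + card (W \<inter> B)"
  using assms card_Un_le[of "W \<inter> A" "W \<inter> B"] by (simp add: Int_Un_distrib[symmetric] Int_absorb2)

text \<open>The round trip to a leaf has length \<open>1 / q\<close>. A drone needs time
  \<open>1 / (q * speed P)\<close> for it, which is at most 1 and more than 1/2: one trip fits into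
  a unit of time, two do not.\<close>

locale tight_star = star_rdp P n h
  for P :: "(nat, 'z) rdp_public_scheme" and n :: nat and h :: real +
  fixes q :: nat
  assumes h_eq: "h = 1 / (2 * q)"
    and speed_lower: "1 \<le> q * speed P" and speed_upper: "q * speed P < 2"
    and speed_pos: "0 < speed P"
begin

lemma q_pos: "0 < q"
  using speed_lower by (cases q) auto

lemma truck_le_1: "cost P p \<le> 1 \<longleftrightarrow> length p \<le> 2 * q"
  using q_pos of_nat_le_iff[where ?'a = real, of "length p" "2 * q"]
  by (simp add: cost_eq h_eq field_simps del: of_nat_le_iff)

lemma truck_less_1: "cost P p < 1 \<longleftrightarrow> length p < 2 * q"
  using q_pos of_nat_less_iff[where ?'a = real, of "length p" "2 * q"]
  by (simp add: cost_eq h_eq field_simps del: of_nat_less_iff)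

lemma drone_le_1:
  assumes "length p \<le> 2"
  shows "1 / speed P * cost P p \<le> 1"
proof -
  have "real (length p) \<le> 2 * (q * speed P)" using assms speed_lower by linarith
  then show ?thesis using q_pos speed_pos by (simp add: cost_eq h_eq field_simps)
qed

lemma drone_length:
  assumes "1 / speed P * cost P p \<le> 1"
  shows "length p < 4"
proof -
  have "real (length p) \<le> 2 * (q * speed P)"
    using assms q_pos speed_pos by (simp add: cost_eq h_eq field_simps)
  then show ?thesis using speed_upper by linarith
qed

lemma card_truck_visits_le:
  assumes "F \<in> families P m k" "1 \<le> m + k" "makespan P F \<le> 1" "0 \<notin> W"
  shows "card (W \<inter> visits P (fst F)) \<le> m * q"
  using assms(1,3) makespan_le_iff[OF assms(1,2)] card_visits_le[of "fst F" q W] assms(4)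
  by (fastforce simp: families_def truck_le_1)

text \<open>In time less than 1 a truck uses fewer than \<open>2 * q\<close> arcs and so serves at
  most \<open>q - 1\<close> leaves, while a drone serves at most one.\<close>

lemma makespan_ge_1:
  assumes F: "tsp_feasible P m k W F" and mk: "1 \<le> m + k" and W: "W \<subseteq> {1..n}"
    and card: "m * (q - 1) + k < card W"
  shows "1 \<le> makespan P F"
proof (rule ccontr)
  assume "\<not> 1 \<le> makespan P F"
  moreover have fam: "F \<in> families P m k" and cov: "W \<subseteq> visits P (fst F) \<union> visits P (snd F)"
    using F by (auto simp: tsp_feasible_def)
  ultimately have "\<forall>p \<in> set (fst F). length p < 2 * q"
    and "\<forall>p \<in> set (snd F). length p < 4"
    using makespan_less_iff[OF fam mk, of 1] drone_length by (auto simp: truck_less_1)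
  moreover have "0 \<notin> W" using W by auto
  ultimately have "card (W \<inter> visits P (fst F)) \<le> m * (q - 1)" "card (W \<inter> visits P (snd F)) \<le> k * 1"
    using fam W q_pos card_visits_le[of "fst F" "q - 1" W] card_visits_le[of "snd F" 1 W]
    by (auto simp: families_def)
  moreover have "finite W" using W finite_subset by auto
  ultimately show False using card_le_covered[OF _ cov] card by fastforce
qed

lemma ex_family:
  assumes "A \<subseteq> {1..n}" "card A \<le> m * q" "B \<subseteq> {1..n}" "card B \<le> k" "1 \<le> m + k"
  shows "\<exists>F \<in> families P m k. A \<subseteq> visits P (fst F) \<and> B \<subseteq> visits P (snd F) \<and> makespan P F \<le> 1"
proof -
  obtain ts where "length ts = m" "\<forall>p \<in> set ts. tour P p \<and> length p \<le> 2 * q" "A \<subseteq> visits P ts"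
    using ex_tours assms by blast
  moreover obtain ds where "length ds = k" "\<forall>p \<in> set ds. tour P p \<and> length p \<le> 2 * 1"
      "B \<subseteq> visits P ds"
    using ex_tours[of B k 1] assms by auto
  ultimately have "(ts, ds) \<in> families P m k" and "A \<subseteq> visits P (fst (ts, ds))"
    "B \<subseteq> visits P (snd (ts, ds))"
    and "makespan P (ts, ds) \<le> 1"
    using makespan_le_iff[of "(ts, ds)" P m k 1] assms(5) drone_le_1
    by (auto simp: families_def truck_le_1)
  then show ?thesis by blast
qed

text \<open>Trucks serve \<open>A\<close> and drones serve \<open>B\<close>, which attains the bound
  of \<open>makespan_ge_1\<close>. With \<open>k = 0\<close> and \<open>B = {}\<close> this also
  covers the second stage.\<close>

lemma tsp_eq_1:
  assumes "A \<union> B = W" "card A \<le> m * q" "card B \<le> k" "1 \<le> m + k" "W \<subseteq> {1..n}"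
    and "m * (q - 1) + k < card W"
  shows "tsp P m k W = 1"
proof -
  obtain F where F: "F \<in> families P m k" "A \<subseteq> visits P (fst F)" "B \<subseteq> visits P (snd F)"
      "makespan P F \<le> 1"
    using ex_family[of A m B k] assms by auto
  then have "tsp_feasible P m k W F" using assms(1) by (auto simp: tsp_feasible_def)
  moreover from this have "makespan P F = 1"
    using makespan_ge_1[of m k W F] assms F(4) by (intro antisym)
  ultimately show ?thesis
    unfolding tsp_def
    using makespan_ge_1[of m k W] assms(4-6) by (intro Least_equality) (blast intro: sym)+
qed

end

section \<open>The adversarial instance\<close>

lemma ceiling_quotient_bound:
  assumes "int q \<le> \<lceil>real kd / real kt\<rceil>" "0 < kt" "0 < q"
  shows "kt * (q - 1) + 1 \<le> kd"
proof -
  \<comment> \<open>The integer \<open>q - 1\<close> lies below the rounded-up quotient, hence below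
    the quotient itself.\<close>
  have "real (q - 1) < real kd / real kt"
    using assms by linarith
  then have "real (kt * (q - 1)) < real kd" using assms(2) by (simp add: field_simps)
  then show ?thesis by linarith
qed

theorem lemma19:
  fixes \<alpha> :: real and kt kd :: nat and S :: "nat rule"
  assumes "0 < \<alpha>" and "\<alpha> < 1" and "1 \<le> kt" and "1 \<le> kd"
    and "\<alpha> * of_int \<lceil>real kd / real kt\<rceil> \<ge> 1"
    and "selection_rule S"
  shows "\<exists>I :: nat rdp. valid_rdp I \<and> num_trucks I = kt \<and> num_drones I = kd \<and> speed I = \<alpha> \<and>
           optimistic S I / opt I = 2"
proof -
  \<comment> \<open>The least natural number with \<open>1 \<le> q * \<alpha>\<close>; rounding up
    gives \<open>q * \<alpha> < 1 + \<alpha> < 2\<close>.\<close>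
  define q where "q = nat \<lceil>1 / \<alpha>\<rceil>"
  have q: "1 \<le> q * \<alpha>" "q * \<alpha> < 2" "0 < q"
  proof -
    have "1 / \<alpha> \<le> q" "q < 1 / \<alpha> + 1"
      using assms(1) ceiling_correct[of "1 / \<alpha>"] unfolding q_def by auto
    then show "1 \<le> q * \<alpha>" "q * \<alpha> < 2" using assms(1,2) by (auto simp: field_simps)
    then show "0 < q" by (cases q) auto
  qed
  have "1 / \<alpha> \<le> of_int \<lceil>real kd / real kt\<rceil>" using assms(1,5) by (simp add: field_simps)
  then have "\<lceil>1 / \<alpha>\<rceil> \<le> \<lceil>real kd / real kt\<rceil>" by (rule ceiling_le)
  then have "int q \<le> \<lceil>real kd / real kt\<rceil>" using q(3) unfolding q_def by linarith
  then have kd: "kt * (q - 1) + 1 \<le> kd"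
    using assms(3) q(3) by (intro ceiling_quotient_bound) auto
  \<comment> \<open>The damaged set chosen below therefore fits into what the trucks can serve in
    one unit of time.\<close>
  have kt: "kt * (q - 1) + 1 \<le> kt * q" using assms(3) q(3) by (cases q) auto

  define n where "n = kt * q + kd"
  \<comment> \<open>The public data are fixed first: the selection rule sees nothing else, so
    \<open>D\<close> can be chosen against its first-stage tours.\<close>
  define P :: "nat rdp_public" where
    "P = \<lparr>road = star n, depot = 0, edge_len = \<lambda>_. 1 / (2 * q),
          num_trucks = kt, num_drones = kd, speed = \<alpha>\<rparr>"
  interpret P: tight_star P n "1 / (2 * q)" q
    using q assms(1) by unfold_locales (auto simp: P_def)

  let ?F = "S P kt kd {1..n}"
  have "is_arg_min (makespan P) (tsp_feasible P kt kd {1..n}) ?F"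
  proof -
    have "valid_public P"
      using assms(1,3,4) by (intro P.valid) (auto simp: P_def n_def)
    then show ?thesis
      using assms(3,6) unfolding selection_rule_def
      by (metis P.customers order.refl trans_le_add1)
  qed
  then have first: "tsp_feasible P kt kd {1..n} ?F"
    and first_min: "\<And>F. tsp_feasible P kt kd {1..n} F \<Longrightarrow> makespan P ?F \<le> makespan P F"
    by (auto simp: is_arg_min_linorder)
  have first_fam: "?F \<in> families P kt kd" using first by (simp add: tsp_feasible_def)
  have split_n: "{1..kt * q} \<union> {kt * q + 1..n} = {1..n}"
    by (auto simp: n_def)
  have "makespan P ?F \<le> 1"
  proof -
    \<comment> \<open>The trucks share the first \<open>kt * q\<close> leaves, and each drone gets
      one of the other \<open>kd\<close>.\<close>
    obtain F where "F \<in> families P kt kd" "{1..kt * q} \<subseteq> visits P (fst F)"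
        "{kt * q + 1..n} \<subseteq> visits P (snd F)" "makespan P F \<le> 1"
      using P.ex_family[of "{1..kt * q}" kt "{kt * q + 1..n}" kd] assms(3) split_n
      by (auto simp: n_def)
    moreover from this have "tsp_feasible P kt kd {1..n} F"
      using split_n unfolding tsp_feasible_def by blast
    ultimately show ?thesis using first_min order.trans by blast
  qed
  then have "card ({1..n} \<inter> visits P (fst ?F)) \<le> kt * q"
    using P.card_truck_visits_le[OF first_fam, of "{1..n}"] assms(3) by auto
  then have "kd \<le> card ({1..n} - visits P (fst ?F))"
    by (simp add: card_Diff_subset_Int n_def)
  \<comment> \<open>One leaf more than the trucks can serve with \<open>q - 1\<close> leaves
    each.\<close>
  then obtain D where D: "D \<subseteq> {1..n} - visits P (fst ?F)" "card D = kt * (q - 1) + 1"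
    using obtain_subset_with_card_n[of "kt * (q - 1) + 1"] kd by (metis order.trans)

  define I :: "nat rdp" where
    "I = \<lparr>road = star n, depot = 0, edge_len = \<lambda>_. 1 / (2 * q),
          num_trucks = kt, num_drones = kd, speed = \<alpha>, damaged = D\<rparr>"
  interpret I: tight_star I n "1 / (2 * q)" q
    using q assms(1) by unfold_locales (auto simp: I_def)
  have I_simps: "num_trucks I = kt" "num_drones I = kd" "speed I = \<alpha>" "damaged I = D"
    "rdp_public.truncate I = P"
    by (auto simp: I_def P_def rdp_public.truncate_def)
  \<comment> \<open>Truncating \<open>I\<close> gives back \<open>P\<close>, so the rule returns the
    same first-stage family, whose trucks miss all of \<open>D\<close>.\<close>
  have rem: "remaining S I = D"
    using D by (auto simp: remaining_def first_stage_def I_simps I.customers I.visits_eq P.visits_eq)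

  have "kt * (q - 1) + kd < n" using kt unfolding n_def by linarith
  then have tsp_all: "tsp I kt kd {1..n} = 1"
    using assms(3) split_n by (intro I.tsp_eq_1) (auto simp: n_def)
  have tsp_rem: "tsp I kt 0 D = 1"
    using D kt assms(3) by (intro I.tsp_eq_1[of D "{}"]) auto
  have opt: "opt I = 1"
  proof -
    \<comment> \<open>The trucks work to capacity: \<open>D\<close> is padded to
      \<open>kt * q\<close> leaves, so that exactly \<open>kd\<close> leaves remain, one per
      drone.\<close>
    obtain T where T: "D \<subseteq> T" "T \<subseteq> {1..n}" "card T = kt * q"
      using exists_subset_between[of D "kt * q" "{1..n}"] D kt by (auto simp: n_def)
    have "finite T" using T finite_subset by blast
    then have "card ({1..n} - T) \<le> kd" using T by (simp add: card_Diff_subset n_def)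
    then obtain F where F: "F \<in> families I kt kd" "T \<subseteq> visits I (fst F)"
        "{1..n} - T \<subseteq> visits I (snd F)" "makespan I F \<le> 1"
      using I.ex_family[of T kt "{1..n} - T" kd] T assms(3) by auto
    \<comment> \<open>A family feasible for \<open>opt\<close> visits all leaves, so the counting
      bound for \<open>{1..n}\<close> applies to it.\<close>
    have lower: "1 \<le> makespan I F" if "opt_feasible I F" for F
      using that \<open>kt * (q - 1) + kd < n\<close> assms(3)
      by (intro I.makespan_ge_1[of kt kd "{1..n}"])
         (auto simp: opt_feasible_def tsp_feasible_def I_simps I.customers)
    from F T have "opt_feasible I F"
      by (auto simp: opt_feasible_def I_simps I.customers)
    moreover from this have "makespan I F = 1" using lower F(4) by (intro antisym)
    ultimately show ?thesis
      unfolding opt_def using lower by (intro Least_equality) (blast intro: sym)+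
  qed

  have "valid_rdp I"
    using D I.valid assms(1,3,4) by (auto simp: valid_rdp_def I_simps I.customers n_def)
  moreover have "optimistic S I = 2"
    by (simp add: optimistic_def I_simps I.customers rem tsp_all tsp_rem del: One_nat_def)
  ultimately show ?thesis
    using opt by (intro exI[of _ I]) (auto simp: I_simps)
qed

end
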